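(* For every metric space $X$, $$\text{\ae}(X)\le 2\Bigl(1-\frac{1}{|X|}\Bigr)\frac{\operatorname{diam} X}{\operatorname{sep} X}.$$
   Context: All Banach spaces are real; subsets of metric spaces carry the induced metric; metric spaces are non-empty. For metric spaces $X\subset Y$, a Banach space $E$ and a Lipschitz map $f\colon X\to E$ with optimal Lipschitz constant $\mathrm{Lip}(f)$, let $e(X,Y,E,f)$ be the infimum of those $K\ge 0$ for which there is a $K\,\mathrm{Lip}(f)$-Lipschitz map $\bar f\colon Y\to E$ extending $f$. Put $\nu(X,Y):=\sup\{e(X,Y,E,f): E\text{ a Banach space}, f\colon X\to E\text{ Lipschitz}\}$ and $\text{\ae}(X):=\sup\{\nu(X,Y): Y\supset X\text{ a metric space}\}$. $\operatorname{diam}X$ is the diameter of $X$ and $\operatorname{sep}X:=\inf\{d(x,x'): x,x'\in X,\ x\ne x'\}$. $|X|$ is the cardinality of $X$. Conventions: $\tfrac{a}{0}=\infty$, $\tfrac{a}{\infty}=0$ and $a\cdot\infty=\infty$ for all $a>0$ (so $1/|X|=0$ if $X$ is infinite); also $\tfrac{\infty}{0}=\infty$, $\tfrac{\infty}{a}=\infty$ for $a>0$ real, and for a one-point space the right-hand side is $0$. *)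

theory Defs
  imports "HOL-Analysis.Analysis"
begin

text \<open>
  HOL cannot form a supremum over all Banach spaces or over all metric spaces, since these range
  over types. The type \<open>'e\<close> of the Banach space \<open>E\<close> and the type \<open>'b\<close> of the points of the
  metric spaces \<open>Y\<close> containing \<open>X\<close> are therefore parameters of the suprema below, passed as
  \<open>TYPE('e)\<close> and \<open>TYPE('b)\<close>. An upper bound for the supremum over all spaces is an upper
  bound for these constants that is uniform in \<open>'b\<close> and \<open>'e\<close>.
\<close>

definition lipschitz_with :: "real \<Rightarrow> 'a metric \<Rightarrow> ('a \<Rightarrow> 'e::real_normed_vector) \<Rightarrow> bool" where
  "lipschitz_with L m f \<longleftrightarrow>
     0 \<le> L \<and> (\<forall>x\<in>mspace m. \<forall>y\<in>mspace m. norm (f x - f y) \<le> L * mdist m x y)"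

text \<open>Meaningful only for Lipschitz maps.\<close>
definition Lip :: "'a metric \<Rightarrow> ('a \<Rightarrow> 'e::real_normed_vector) \<Rightarrow> real" where
  "Lip m f = Inf {L. lipschitz_with L m f}"

text \<open>
  \<open>e(X,Y,E,f)\<close> for a subset \<open>X\<close> of the metric space \<open>Y\<close>; only the values of \<open>f\<close> on \<open>X\<close> matter.
\<close>
definition ext_const :: "'b set \<Rightarrow> 'b metric \<Rightarrow> ('b \<Rightarrow> 'e::real_normed_vector) \<Rightarrow> ennreal" where
  "ext_const X Y f =
     Inf {ennreal K | K. 0 \<le> K \<and>
       (\<exists>g. lipschitz_with (K * Lip (submetric Y X) f) Y g \<and> (\<forall>x\<in>X. g x = f x))}"

definition nu :: "'e::banach itself \<Rightarrow> 'b set \<Rightarrow> 'b metric \<Rightarrow> ennreal" where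
  "nu _ X Y =
     Sup {ext_const X Y f | f :: 'b \<Rightarrow> 'e. \<exists>L. lipschitz_with L (submetric Y X) f}"

definition isometric_embedding :: "'a metric \<Rightarrow> 'b metric \<Rightarrow> ('a \<Rightarrow> 'b) \<Rightarrow> bool" where
  "isometric_embedding X Y i \<longleftrightarrow>
     i \<in> mspace X \<rightarrow> mspace Y \<and>
     (\<forall>x\<in>mspace X. \<forall>x'\<in>mspace X. mdist Y (i x) (i x') = mdist X x x')"

text \<open>
  A metric space containing \<open>X\<close> is a metric space \<open>Y\<close> with an isometric copy of \<open>X\<close> inside it,
  so that its points may live in any type \<open>'b\<close>, however small the type \<open>'a\<close> is.
\<close>
definition ae :: "'b itself \<Rightarrow> 'e::banach itself \<Rightarrow> 'a metric \<Rightarrow> ennreal" where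
  "ae _ E X =
     Sup {nu E (i ` mspace X) Y | (Y :: 'b metric) i. isometric_embedding X Y i}"

definition ediam :: "'a metric \<Rightarrow> ennreal" where
  "ediam X = (SUP x\<in>mspace X. SUP x'\<in>mspace X. ennreal (mdist X x x'))"

text \<open>The infimum is \<open>\<infinity>\<close> for a one-point space.\<close>
definition esep :: "'a metric \<Rightarrow> ennreal" where
  "esep X = Inf {ennreal (mdist X x x') | x x'. x \<in> mspace X \<and> x' \<in> mspace X \<and> x \<noteq> x'}"

text \<open>Unlike \<open>card\<close>, this is \<open>\<infinity>\<close> on infinite sets.\<close>
definition ecard :: "'a set \<Rightarrow> ennreal" where
  "ecard A = (if finite A then of_nat (card A) else \<infinity>)"

text \<open>
  Division in \<^typ>\<open>ennreal\<close> satisfies \<open>a / 0 = \<infinity>\<close> for \<open>a > 0\<close> (also for \<open>a = \<infinity>\<close>),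
  \<open>a / \<infinity> = 0\<close> and \<open>\<infinity> / a = \<infinity>\<close> for real \<open>a\<close>; the one-point
  case is \<open>0 / \<infinity> = 0\<close>.
\<close>

end

theory Submission
  imports Defs
begin

text \<open>
  Suppose that distinct points of \<open>X\<close> have distances between \<open>s > 0\<close> and \<open>D < \<infinity>\<close>, and let \<open>f\<close>
  be \<open>L\<close>-Lipschitz on \<open>X\<close>. The open balls of radius \<open>s/2\<close> around the points of \<open>X\<close>
  are disjoint in every \<open>Y \<supseteq> X\<close>, so \<open>f\<close> can be extended by a constant \<open>c\<close> outside
  these balls and by interpolating linearly in the radius between \<open>f x\<close> at the centre
  and \<open>c\<close> on the boundary of the ball around \<open>x\<close>. The cones have slope
  at most \<open>2R/s\<close> if all values of \<open>f\<close> are within \<open>R\<close> of \<open>c\<close>, and passing from one ball to another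
  costs no more, because the gap between the two points of \<open>X\<close> is at least twice the radius
  (lemma \<open>lipschitz_cone_extension\<close>).

  The factor \<open>1 - 1/|X|\<close> comes from the choice of \<open>c\<close>. If \<open>X\<close> is finite, \<open>c\<close> is the mean of the
  values of \<open>f\<close>: then \<open>f x - c\<close> is the mean of the \<open>|X|\<close> differences \<open>f x - f x'\<close>, one of which
  vanishes while the others have norm at most \<open>L D\<close>. If \<open>X\<close> is infinite, any value of \<open>f\<close> will do
  (lemma \<open>exists_centre\<close>).

  If the diameter is infinite or the separation is zero, then \<open>X\<close> has more than one point and the
  claimed bound is infinite.
\<close>

section \<open>Extending by cones\<close>

text \<open>
  The optimal constant is attained because the Lipschitz condition is a family of non-strict
  inequalities.
\<close>
lemma lipschitz_with_Lip:
  assumes "lipschitz_with L m f"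
  shows "lipschitz_with (Lip m f) m f"
proof -
  let ?S = "{L. lipschitz_with L m f}"
  have ne: "?S \<noteq> {}" using assms by blast
  have "0 \<le> Lip m f"
    unfolding Lip_def by (rule cInf_greatest[OF ne]) (simp add: lipschitz_with_def)
  moreover have "norm (f x - f y) \<le> Lip m f * mdist m x y"
    if x: "x \<in> mspace m" and y: "y \<in> mspace m" for x y
  proof (cases "mdist m x y = 0")
    case True
    then have "x = y" using x y by simp
    with True show ?thesis by simp
  next
    case False
    then have pos: "mdist m x y > 0" by (simp add: order_less_le)
    have "norm (f x - f y) / mdist m x y \<le> Lip m f"
      unfolding Lip_def
    proof (rule cInf_greatest[OF ne])
      fix M assume "M \<in> ?S"
      then show "norm (f x - f y) / mdist m x y \<le> M"
        using x y pos by (simp add: lipschitz_with_def divide_le_eq)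
    qed
    then show ?thesis using pos by (simp add: divide_le_eq)
  qed
  ultimately show ?thesis by (simp add: lipschitz_with_def)
qed

text \<open>
  Inside one ball the extension varies only with the weight, whose slope is \<open>2/s\<close>. For two points
  belonging to different \<open>x\<close> and \<open>x'\<close>, comparing both values with \<open>c\<close> leaves \<open>R\<close> times the sum of
  the two weights; if both are positive, \<open>s \<le> d(x,x') \<le> d(x,y) + d(y,y') + d(y',x')\<close> bounds this
  sum by \<open>2 d(y,y') / s\<close>.
\<close>
lemma lipschitz_cone_extension:
  fixes f :: "'b \<Rightarrow> 'e::real_normed_vector"
  assumes X: "X \<subseteq> mspace Y" "X \<noteq> {}"
    and s: "0 < s" "\<And>x x'. \<lbrakk>x \<in> X; x' \<in> X; x \<noteq> x'\<rbrakk> \<Longrightarrow> s \<le> mdist Y x x'"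
    and R: "\<And>x. x \<in> X \<Longrightarrow> norm (f x - c) \<le> R"
  shows "\<exists>g. lipschitz_with (2 * R / s) Y g \<and> (\<forall>x\<in>X. g x = f x)"
proof -
  define w where "w x y = max 0 (1 - 2 * mdist Y x y / s)" for x y
  have R0: "0 \<le> R" using X(2) R norm_ge_zero order_trans by blast
  have tri: "mdist Y x z \<le> mdist Y x y + mdist Y y z"
    if "x \<in> mspace Y" "y \<in> mspace Y" "z \<in> mspace Y" for x y z
    using that by (rule mdist_triangle)
  \<comment> \<open>\<open>p y\<close> is the point of \<open>X\<close> whose ball contains \<open>y\<close>, and arbitrary if there is none; in that case
    the weight vanishes.\<close>
  have "\<exists>q\<in>X. \<forall>x\<in>X. mdist Y x y < s/2 \<longrightarrow> q = x" if y: "y \<in> mspace Y" for y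
  proof (cases "\<exists>q\<in>X. mdist Y q y < s/2")
    case True
    then obtain q where q: "q \<in> X" "mdist Y q y < s/2" by blast
    have "q = x" if x: "x \<in> X" "mdist Y x y < s/2" for x
    proof (rule ccontr)
      assume "q \<noteq> x"
      then have "s \<le> mdist Y q x" using s(2) q x by blast
      also have "\<dots> \<le> mdist Y q y + mdist Y x y"
        using tri[of q y x] q x y X(1) mdist_commute[of Y x y] by auto
      finally show False using q x by simp
    qed
    then show ?thesis using q(1) by blast
  qed (use X(2) in blast)
  then obtain p where p: "\<And>y. y \<in> mspace Y \<Longrightarrow> p y \<in> X"
    "\<And>x y. \<lbrakk>y \<in> mspace Y; x \<in> X; mdist Y x y < s/2\<rbrakk> \<Longrightarrow> p y = x"
    by metis
  define g where "g y = c + w (p y) y *\<^sub>R (f (p y) - c)" for y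
  have w0: "0 \<le> w x y" for x y by (simp add: w_def)
  have w_lip: "w x y - w x y' \<le> 2 / s * mdist Y y y'"
    if "x \<in> X" "y \<in> mspace Y" "y' \<in> mspace Y" for x y y'
  proof -
    have "mdist Y x y' \<le> mdist Y x y + mdist Y y y'" using tri that X(1) by blast
    then have "2 * mdist Y x y' / s \<le> 2 * mdist Y x y / s + 2 / s * mdist Y y y'"
      using s(1) by (simp add: field_simps)
    moreover have "0 \<le> 2 / s * mdist Y y y'" using s(1) by simp
    ultimately show ?thesis by (simp add: w_def max_def)
  qed
  have w_out: "w x y = 0" if "y \<in> mspace Y" "x \<in> X" "p y \<noteq> x" for x y
    using p(2)[OF that(1,2)] that(3) s(1) by (force simp: w_def field_simps)
  have w_sum: "w (p y) y + w (p y') y' \<le> 2 / s * mdist Y y y'"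
    if y: "y \<in> mspace Y" and y': "y' \<in> mspace Y" and ne: "p y \<noteq> p y'" for y y'
  proof (cases "w (p y) y = 0 \<or> w (p y') y' = 0")
    case True
    \<comment> \<open>One weight is zero. The cone of the other point vanishes at this one, because the balls are
      disjoint, so the sum is the change of a single cone between \<open>y\<close> and \<open>y'\<close>.\<close>
    moreover have "w (p y) y' = 0" "w (p y') y = 0" using w_out p(1) y y' ne by metis+
    ultimately show ?thesis
      using w_lip[OF p(1)[OF y] y y'] w_lip[OF p(1)[OF y'] y' y] mdist_commute[of Y y y'] by auto
  next
    case False
    have "s \<le> mdist Y (p y) (p y')" using s(2) p(1) y y' ne by blast
    also have "\<dots> \<le> mdist Y (p y) y + mdist Y y y' + mdist Y (p y') y'"
    proof -
      have "p y \<in> mspace Y" "p y' \<in> mspace Y" using p(1) y y' X(1) by blast+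
      then show ?thesis
        using tri[of "p y" y "p y'"] tri[of y y' "p y'"] y y' mdist_commute[of Y y' "p y'"] by simp
    qed
    finally have "2 \<le> 2 * mdist Y (p y) y / s + 2 / s * mdist Y y y' + 2 * mdist Y (p y') y' / s"
      using s(1) by (simp add: field_simps)
    then show ?thesis using False by (simp add: w_def max_def split: if_splits)
  qed
  have "norm (g y - g y') \<le> 2 * R / s * mdist Y y y'"
    if y: "y \<in> mspace Y" and y': "y' \<in> mspace Y" for y y'
  proof (cases "p y = p y'")
    case True
    have "g y - g y' = (w (p y) y - w (p y) y') *\<^sub>R (f (p y) - c)"
      by (simp add: g_def True algebra_simps)
    then have "norm (g y - g y') = \<bar>w (p y) y - w (p y) y'\<bar> * norm (f (p y) - c)" by simp
    also have "\<dots> \<le> (2 / s * mdist Y y y') * R"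
      using w_lip[OF p(1)[OF y] y y'] w_lip[OF p(1)[OF y] y' y] mdist_commute[of Y y y']
        R[OF p(1)[OF y]] s(1)
      by (intro mult_mono) auto
    finally show ?thesis by (simp add: mult_ac)
  next
    case False
    have "g y - g y' = w (p y) y *\<^sub>R (f (p y) - c) - w (p y') y' *\<^sub>R (f (p y') - c)"
      by (simp add: g_def)
    then have "norm (g y - g y') \<le> w (p y) y * norm (f (p y) - c) + w (p y') y' * norm (f (p y') - c)"
      using norm_triangle_ineq4[of "w (p y) y *\<^sub>R (f (p y) - c)" "w (p y') y' *\<^sub>R (f (p y') - c)"]
        w0 by simp
    also have "\<dots> \<le> w (p y) y * R + w (p y') y' * R"
      using R p(1) y y' w0 by (intro add_mono mult_left_mono) auto
    also have "\<dots> = (w (p y) y + w (p y') y') * R" by (simp add: algebra_simps)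
    also have "\<dots> \<le> (2 / s * mdist Y y y') * R"
      using w_sum[OF y y' False] R0 by (rule mult_right_mono)
    finally show ?thesis by (simp add: mult_ac)
  qed
  then have "lipschitz_with (2 * R / s) Y g"
    using R0 s(1) by (simp add: lipschitz_with_def)
  moreover have "g x = f x" if x: "x \<in> X" for x
  proof -
    have xY: "x \<in> mspace Y" using x X(1) by blast
    then have d: "mdist Y x x = 0" by simp
    then have "p x = x" using p(2)[OF xY x] s(1) by simp
    moreover have "w x x = 1" using d by (simp add: w_def)
    ultimately show ?thesis by (simp add: g_def)
  qed
  ultimately show ?thesis by blast
qed

section \<open>The choice of the centre\<close>

text \<open>
  Averaging over \<open>X\<close> makes the vanishing term \<open>f x - f x\<close> count, which gains \<open>M / |X|\<close>. For infinite
  \<open>X\<close> the factor is \<open>1\<close>, because \<open>card X = 0\<close> and \<open>1 / 0 = 0\<close> in the reals, and any value of \<open>f\<close>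
  is a centre.
\<close>
lemma exists_centre:
  fixes f :: "'b \<Rightarrow> 'e::real_normed_vector"
  assumes "X \<noteq> {}" and M: "\<And>x x'. \<lbrakk>x \<in> X; x' \<in> X\<rbrakk> \<Longrightarrow> norm (f x - f x') \<le> M"
  shows "\<exists>c. \<forall>x\<in>X. norm (f x - c) \<le> (1 - 1 / real (card X)) * M"
proof (cases "finite X")
  case False
  obtain x0 where "x0 \<in> X" using assms(1) by blast
  then show ?thesis using False M by (intro exI[of _ "f x0"]) simp
next
  case True
  let ?n = "real (card X)"
  have n: "?n > 0" using True assms(1) by (simp add: card_gt_0_iff)
  have "norm (f x - (\<Sum>x'\<in>X. f x') /\<^sub>R ?n) \<le> (1 - 1 / ?n) * M" if x: "x \<in> X" for x
  proof -
    have "f x - (\<Sum>x'\<in>X. f x') /\<^sub>R ?n = (\<Sum>x'\<in>X. f x - f x') /\<^sub>R ?n"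
      using n by (simp add: sum_subtractf sum_constant_scaleR scaleR_diff_right)
    also have "(\<Sum>x'\<in>X. f x - f x') = (\<Sum>x'\<in>X - {x}. f x - f x')"
      using True x by (simp add: sum.remove)
    finally have "norm (f x - (\<Sum>x'\<in>X. f x') /\<^sub>R ?n) = norm (\<Sum>x'\<in>X - {x}. f x - f x') / ?n"
      by (simp add: divide_inverse mult.commute)
    also have "\<dots> \<le> (real (card (X - {x})) * M) / ?n"
      using M x n by (intro divide_right_mono sum_norm_bound) auto
    also have "\<dots> = (1 - 1 / ?n) * M"
      using True x n by (simp add: card_Diff_singleton of_nat_diff Suc_le_eq card_gt_0_iff field_simps)
    finally show ?thesis .
  qed
  then show ?thesis by blast
qed

section \<open>The bound for real distances\<close>

lemma ext_const_le:
  fixes f :: "'b \<Rightarrow> 'e::real_normed_vector"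
  assumes X: "X \<subseteq> mspace Y" "X \<noteq> {}"
    and s: "0 < s" "\<And>x x'. \<lbrakk>x \<in> X; x' \<in> X; x \<noteq> x'\<rbrakk> \<Longrightarrow> s \<le> mdist Y x x'"
    and D: "\<And>x x'. \<lbrakk>x \<in> X; x' \<in> X\<rbrakk> \<Longrightarrow> mdist Y x x' \<le> D"
    and f: "lipschitz_with L (submetric Y X) f"
  shows "ext_const X Y f \<le> ennreal (2 * (1 - 1 / real (card X)) * (D / s))"
proof -
  define q where "q = 1 - 1 / real (card X)"
  define M where "M = Lip (submetric Y X) f"
  have M: "lipschitz_with M (submetric Y X) f"
    unfolding M_def using f by (rule lipschitz_with_Lip)
  then have "norm (f x - f x') \<le> M * D" if "x \<in> X" "x' \<in> X" for x x'
  proof -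
    have "0 \<le> M" "norm (f x - f x') \<le> M * mdist Y x x'"
      using M that X(1) by (auto simp: lipschitz_with_def subset_iff)
    then show ?thesis using mult_left_mono[OF D[OF that]] by (meson order_trans)
  qed
  then have "\<exists>c. \<forall>x\<in>X. norm (f x - c) \<le> q * (M * D)"
    unfolding q_def by (rule exists_centre[OF X(2)])
  then obtain c where c: "\<And>x. x \<in> X \<Longrightarrow> norm (f x - c) \<le> q * (M * D)" by blast
  have "\<exists>g. lipschitz_with (2 * (q * (M * D)) / s) Y g \<and> (\<forall>x\<in>X. g x = f x)"
    by (rule lipschitz_cone_extension[OF X s(1)]) (use s(2) c in auto)
  then obtain g where g: "lipschitz_with (2 * (q * (M * D)) / s) Y g" "\<forall>x\<in>X. g x = f x"
    by blast
  have "0 \<le> q"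
    by (cases "card X = 0") (auto simp: q_def)
  moreover have "0 \<le> D"
  proof -
    obtain x where "x \<in> X" using X(2) by blast
    then show ?thesis using D[of x x] mdist_nonneg[of Y x x] by linarith
  qed
  ultimately have "0 \<le> 2 * q * (D / s)" using s(1) by simp
  moreover have "lipschitz_with (2 * q * (D / s) * M) Y g"
    using g(1) by (simp add: mult_ac)
  ultimately show ?thesis
    unfolding ext_const_def q_def[symmetric] M_def[symmetric]
    using g(2) by (intro Inf_lower) blast
qed

lemma ae_le:
  fixes X :: "'a metric"
  assumes ne: "mspace X \<noteq> {}"
    and s: "0 < s" "\<And>x x'. \<lbrakk>x \<in> mspace X; x' \<in> mspace X; x \<noteq> x'\<rbrakk> \<Longrightarrow> s \<le> mdist X x x'"
    and D: "\<And>x x'. \<lbrakk>x \<in> mspace X; x' \<in> mspace X\<rbrakk> \<Longrightarrow> mdist X x x' \<le> D"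
  shows "ae TYPE('b) TYPE('e::banach) X
           \<le> ennreal (2 * (1 - 1 / real (card (mspace X))) * (D / s))"
proof -
  have "ext_const (i ` mspace X) Y f \<le> ennreal (2 * (1 - 1 / real (card (mspace X))) * (D / s))"
    if i: "isometric_embedding X Y i" and f: "lipschitz_with L (submetric Y (i ` mspace X)) f"
    for Y :: "'b metric" and i L and f :: "'b \<Rightarrow> 'e"
  proof -
    have d: "mdist Y (i x) (i x') = mdist X x x'" if "x \<in> mspace X" "x' \<in> mspace X" for x x'
      using i that by (simp add: isometric_embedding_def)
    have "inj_on i (mspace X)"
    proof (rule inj_onI)
      fix x x' assume x: "x \<in> mspace X" "x' \<in> mspace X" "i x = i x'"
      then have "i x' \<in> mspace Y" using i by (auto simp: isometric_embedding_def)
      then have "mdist X x x' = 0" using d[OF x(1,2)] x(3) mdist_zero by metis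
      then show "x = x'" using x by simp
    qed
    then have "card (i ` mspace X) = card (mspace X)" by (rule card_image)
    moreover have "ext_const (i ` mspace X) Y f
        \<le> ennreal (2 * (1 - 1 / real (card (i ` mspace X))) * (D / s))"
    proof (rule ext_const_le[OF _ _ s(1) _ _ f])
      show "i ` mspace X \<subseteq> mspace Y" using i by (auto simp: isometric_embedding_def)
      show "i ` mspace X \<noteq> {}" using ne by simp
      show "s \<le> mdist Y y y'" if "y \<in> i ` mspace X" "y' \<in> i ` mspace X" "y \<noteq> y'" for y y'
        using that d s(2) by fastforce
      show "mdist Y y y' \<le> D" if "y \<in> i ` mspace X" "y' \<in> i ` mspace X" for y y'
        using that d D by fastforce
    qed
    ultimately show ?thesis by simp
  qed
  then have "nu TYPE('e) (i ` mspace X) Y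
      \<le> ennreal (2 * (1 - 1 / real (card (mspace X))) * (D / s))"
    if "isometric_embedding X Y i" for Y :: "'b metric" and i
    unfolding nu_def using that by (intro Sup_least) blast
  then show ?thesis unfolding ae_def by (intro Sup_least) blast
qed

section \<open>The bound in the extended reals\<close>

lemma mdist_le_ediam:
  "\<lbrakk>x \<in> mspace X; x' \<in> mspace X\<rbrakk> \<Longrightarrow> ennreal (mdist X x x') \<le> ediam X"
  unfolding ediam_def by (meson SUP_upper2 order_refl)

lemma esep_le_mdist:
  "\<lbrakk>x \<in> mspace X; x' \<in> mspace X; x \<noteq> x'\<rbrakk> \<Longrightarrow> esep X \<le> ennreal (mdist X x x')"
  unfolding esep_def by (rule Inf_lower) blast

lemma ecard_factor:
  assumes "A \<noteq> {}"
  shows "1 - 1 / ecard A = ennreal (1 - 1 / real (card A))"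
proof (cases "finite A")
  case True
  then have n: "1 \<le> real (card A)" using assms by (simp add: Suc_le_eq card_gt_0_iff)
  then have "1 / ecard A = ennreal (1 / real (card A))"
    using True divide_ennreal[of 1 "real (card A)"] by (simp add: ecard_def ennreal_of_nat_eq_real_of_nat)
  then show ?thesis using n by (simp flip: ennreal_1 add: ennreal_minus)
qed (simp add: ecard_def)

theorem proposition1p7:
  fixes X :: "'a metric"
  assumes "mspace X \<noteq> {}"
  shows "ae TYPE('b) TYPE('e::banach) X
           \<le> 2 * (1 - 1 / ecard (mspace X)) * (ediam X / esep X)"
proof (cases "\<exists>a. mspace X = {a}")
  case True
  then obtain a where a: "mspace X = {a}" by blast
  \<comment> \<open>No two points are distinct, so any positive separation serves; \<open>1\<close> is chosen.\<close>
  have "ae TYPE('b) TYPE('e) X \<le> ennreal (2 * (1 - 1 / real (card (mspace X))) * (0 / 1))"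
    by (rule ae_le) (auto simp: a intro: eq_refl)
  then show ?thesis by simp
next
  case False
  then obtain a b where ab: "a \<in> mspace X" "b \<in> mspace X" "a \<noteq> b" using assms by blast
  let ?q = "1 - 1 / real (card (mspace X))"
  have q: "0 < ?q"
  proof (cases "finite (mspace X)")
    case True
    have "card {a, b} \<le> card (mspace X)" using ab True by (intro card_mono) auto
    then show ?thesis using ab by simp
  qed simp
  have sep_diam: "esep X \<le> ediam X" and sep_fin: "esep X < \<infinity>" and diam_pos: "0 < ediam X"
  proof -
    have d: "0 < mdist X a b" using ab by (simp add: order_less_le)
    have 1: "esep X \<le> ennreal (mdist X a b)" using ab by (rule esep_le_mdist)
    have 2: "ennreal (mdist X a b) \<le> ediam X" using ab(1,2) by (rule mdist_le_ediam)
    show "esep X \<le> ediam X" using 1 2 by (rule order_trans)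
    show "esep X < \<infinity>" using 1 by (rule le_less_trans) simp
    show "0 < ediam X" using d 2 by (simp add: less_le_trans[of 0 "ennreal (mdist X a b)"])
  qed
  show ?thesis
  proof (cases "esep X = 0 \<or> ediam X = \<infinity>")
    case True
    then have "ediam X / esep X = \<infinity>"
      using sep_fin diam_pos by (auto simp: ennreal_top_divide ennreal_divide_eq_top_iff)
    moreover have "2 * (1 - 1 / ecard (mspace X)) \<noteq> 0"
      unfolding ecard_factor[OF assms] using q
      by (simp del: diff_gt_0_iff_gt add: ennreal_eq_0_iff not_le)
    ultimately show ?thesis by (simp add: ennreal_mult_top)
  next
    case False
    obtain s where s: "esep X = ennreal s" "0 < s"
      using False sep_fin by (cases "esep X") (auto simp: ennreal_eq_0_iff)
    obtain D where D: "ediam X = ennreal D" "0 \<le> D"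
      using False by (cases "ediam X") auto
    have "ae TYPE('b) TYPE('e) X \<le> ennreal (2 * ?q * (D / s))"
    proof (rule ae_le[OF assms s(2)])
      show "s \<le> mdist X x x'" if "x \<in> mspace X" "x' \<in> mspace X" "x \<noteq> x'" for x x'
        using esep_le_mdist[OF that] s by (simp add: ennreal_le_iff)
      show "mdist X x x' \<le> D" if "x \<in> mspace X" "x' \<in> mspace X" for x x'
        using mdist_le_ediam[OF that] D by (simp add: ennreal_le_iff)
    qed
    also have "\<dots> = ennreal 2 * ennreal ?q * ennreal (D / s)"
      using q s(2) D(2)
      by (simp only: ennreal_mult mult_nonneg_nonneg divide_nonneg_pos less_imp_le zero_le_numeral)
    also have "\<dots> = 2 * (1 - 1 / ecard (mspace X)) * (ediam X / esep X)"
      using s D by (simp add: ecard_factor[OF assms] divide_ennreal)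
    finally show ?thesis .
  qed
qed

end
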